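(* Suppose that $f\in C^2[a,b]$ and $X$ is a partition of $[a,b]$. If $t_\alpha\in T_\alpha^1(X)$ is such that $t_\alpha|_X=f|_X$, then for $\alpha$ sufficiently small, we have $$\|f-t_\alpha\|_{L^\infty[a,b]}\le C\,\overline{h}^2,$$ where $C>0$ depends on $f$ and $\alpha$. The same is true if $t_\alpha$ is replaced by $s_\alpha\in S_\alpha^1(X)$ (with $s_\alpha|_X=f|_X$).
   Context: A partition of $[a,b]$ is a sequence $X=(x_j:0\le j\le N)$ with $a=x_0<x_1<\cdots<x_N=b$; its mesh size is $\overline{h}=\overline{h}(X)=\max_{1\le j\le N}(x_j-x_{j-1})$. For $\alpha>0$ (with $D=d/dx$), $$S_\alpha^1(X)=\{s\in C[a,b]:(D^2-\alpha^2)s=0\text{ on }[a,b]\setminus X\},$$ i.e. continuous functions which on each $[x_{j-1},x_j]$ have the form $p\cosh(\alpha x)+q\sinh(\alpha x)$ with constants $p,q$, and $$T_\alpha^1(X)=\{\operatorname{sech}(\alpha\,\cdot)\,u:u\in S_\alpha^1(X)\},$$ i.e. continuous functions which on each $[x_{j-1},x_j]$ have the form $p+q\tanh(\alpha x)$ with constants $p,q$. *)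

theory Defs
  imports "HOL-Analysis.Analysis" "HOL-Probability.Essential_Supremum"
begin

definition is_partition :: "real \<Rightarrow> real \<Rightarrow> nat \<Rightarrow> (nat \<Rightarrow> real) \<Rightarrow> bool" where
  "is_partition a b N x \<longleftrightarrow> x 0 = a \<and> x N = b \<and> (\<forall>j<N. x j < x (Suc j))"

text \<open>Only the values \<open>x 0, \<dots>, x N\<close> matter; \<open>mesh\<close> is meant for \<open>N \<ge> 1\<close>, which holds for every
  partition of \<open>{a..b}\<close> when \<open>a < b\<close>.\<close>

definition knots :: "nat \<Rightarrow> (nat \<Rightarrow> real) \<Rightarrow> real set" where
  "knots N x = x ` {0..N}"

definition mesh :: "nat \<Rightarrow> (nat \<Rightarrow> real) \<Rightarrow> real" where
  "mesh N x = Max ((\<lambda>j. x j - x (j - 1)) ` {1..N})"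

text \<open>Derivatives relative to \<open>{a..b}\<close>: one-sided at the endpoints.\<close>

definition C2_on_interval :: "real \<Rightarrow> real \<Rightarrow> (real \<Rightarrow> real) \<Rightarrow> bool" where
  "C2_on_interval a b f \<longleftrightarrow>
     (\<exists>f' f''. (\<forall>y\<in>{a..b}. (f has_real_derivative f' y) (at y within {a..b})) \<and>
               (\<forall>y\<in>{a..b}. (f' has_real_derivative f'' y) (at y within {a..b})) \<and>
               continuous_on {a..b} f'')"

text \<open>Elements of the spline spaces are represented by functions on \<open>\<real>\<close> whose values outside
  \<open>{a..b}\<close> are arbitrary. Since \<open>a\<close> and \<open>b\<close> are knots, \<open>{a..b} - knots N x\<close> is open, and
  \<open>s'\<close> is the ordinary derivative of \<open>s\<close> on it.\<close>

definition S_space :: "real \<Rightarrow> real \<Rightarrow> real \<Rightarrow> nat \<Rightarrow> (nat \<Rightarrow> real) \<Rightarrow> (real \<Rightarrow> real) set" where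
  "S_space a b \<alpha> N x =
     {s. continuous_on {a..b} s \<and>
         (\<exists>s' s''. \<forall>y \<in> {a..b} - knots N x.
            (s has_real_derivative s' y) (at y) \<and>
            (s' has_real_derivative s'' y) (at y) \<and>
            s'' y - \<alpha>\<^sup>2 * s y = 0)}"

definition sech :: "real \<Rightarrow> real" where
  "sech y = 1 / cosh y"

definition T_space :: "real \<Rightarrow> real \<Rightarrow> real \<Rightarrow> nat \<Rightarrow> (nat \<Rightarrow> real) \<Rightarrow> (real \<Rightarrow> real) set" where
  "T_space a b \<alpha> N x = {(\<lambda>y. sech (\<alpha> * y) * u y) |u. u \<in> S_space a b \<alpha> N x}"

text \<open>\<open>esssup\<close> requires a complete order, hence the extended reals; it is \<open>\<infinity>\<close> for
  non-measurable functions.\<close>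

definition Linf_norm :: "real \<Rightarrow> real \<Rightarrow> (real \<Rightarrow> real) \<Rightarrow> ereal" where
  "Linf_norm a b g = esssup (lebesgue_on {a..b}) (\<lambda>y. ereal \<bar>g y\<bar>)"

end

theory Submission
  imports Defs
begin

text \<open>On a subinterval \<open>[p, q]\<close> of the partition the error \<open>e = f - s\<close> vanishes at both ends and
  satisfies \<open>e'' - \<alpha>\<^sup>2 e = f'' - \<alpha>\<^sup>2 f\<close>, whose right-hand side is bounded by some \<open>G\<close>. By the maximum
  principle, \<open>\<bar>e\<bar>\<close> stays below the barrier \<open>G (y - p) (q - y) / 2\<close>. For \<open>T_space\<close> one multiplies
  by \<open>cosh (\<alpha> y)\<close>: if \<open>t = sech (\<alpha> \<cdot>) u\<close> interpolates \<open>f\<close>, then \<open>u\<close> interpolates \<open>cosh (\<alpha> \<cdot>) f\<close>, and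
  \<open>cosh \<ge> 1\<close> transfers the bound back.\<close>

section \<open>Maximum principle and parabolic barrier\<close>

lemma maximum_principle:
  fixes v v' v'' :: "real \<Rightarrow> real"
  assumes cont: "continuous_on {p..q} v"
    and d1: "\<And>y. y \<in> {p<..<q} \<Longrightarrow> (v has_real_derivative v' y) (at y)"
    and d2: "\<And>y. y \<in> {p<..<q} \<Longrightarrow> (v' has_real_derivative v'' y) (at y)"
    and pos: "\<And>y. y \<in> {p<..<q} \<Longrightarrow> v y > 0 \<Longrightarrow> v'' y > 0"
    and ends: "v p \<le> 0" "v q \<le> 0"
    and y: "y \<in> {p..q}"
  shows "v y \<le> 0"
proof (rule ccontr)
  assume "\<not> v y \<le> 0"
  have "{p..q} \<noteq> {}"
    using y by auto
  with cont obtain z where z: "z \<in> {p..q}" and zmax: "\<And>u. u \<in> {p..q} \<Longrightarrow> v u \<le> v z"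
    using continuous_attains_sup[of "{p..q}" v] by auto
  have vz: "v z > 0"
    using \<open>\<not> v y \<le> 0\<close> zmax[OF y] by linarith
  then have zi: "z \<in> {p<..<q}"
    using z ends by (metis atLeastAtMost_iff greaterThanLessThan_iff less_eq_real_def not_less)
  \<comment> \<open>The positive maximum \<open>z\<close> is interior because of
    \<open>ends\<close>, so the slope vanishes there while \<open>pos\<close> gives
    \<open>v'' z > 0\<close>. Hence \<open>v'\<close> is positive just to the right of
    \<open>z\<close>, and by the mean value theorem \<open>v\<close> would rise above its
    maximum.\<close>
  have "v' z = 0"
  proof (rule DERIV_local_max[OF d1[OF zi]])
    show "0 < min (z - p) (q - z)"
      using zi by simp
    show "\<forall>u. \<bar>z - u\<bar> < min (z - p) (q - z) \<longrightarrow> v u \<le> v z"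
      by (auto intro!: zmax)
  qed
  moreover obtain d where d: "d > 0" "\<And>h. 0 < h \<Longrightarrow> h < d \<Longrightarrow> v' z < v' (z + h)"
    using DERIV_pos_inc_right[OF d2[OF zi] pos[OF zi vz]] by blast
  \<comment> \<open>Halving makes both \<open>h < d\<close> and \<open>z + h < q\<close> strict. The
    mean value point \<open>u\<close> then satisfies \<open>0 < u - z < d\<close>, where
    \<open>v'\<close> exceeds \<open>v' z = 0\<close>.\<close>
  moreover define h where "h = min d (q - z) / 2"
  have h: "0 < h" "h < d" "z + h < q"
    using d(1) zi by (auto simp: h_def min_def field_simps)
  obtain l u where u: "z < u" "u < z + h" "v (z + h) - v z = (z + h - z) * v' u"
    using MVT2[of z "z + h" v v'] d1 h zi by (metis add.commute greaterThanLessThan_iff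
      less_add_same_cancel2 less_le_trans le_less_trans)
  ultimately have "v' u > 0"
    using d(2)[of "u - z"] h by auto
  then have "v (z + h) > v z"
    using u h by (simp add: algebra_simps)
  then show False
    using zmax[of "z + h"] zi h by auto
qed

text \<open>The parabola \<open>G * (y - p) * (q - y) / 2\<close> vanishes at both ends and has
  second derivative \<open>- G\<close>. Wherever \<open>e\<close> exceeds it, \<open>e\<close> is
  positive, so \<open>ode\<close> forces \<open>e'' > - G\<close> and the difference has positive
  second derivative. The strict inequality in \<open>ode\<close> matches the strict sign that
  \<open>maximum_principle\<close> asks for.\<close>

lemma barrier_bound:
  fixes e e' e'' :: "real \<Rightarrow> real"
  assumes cont: "continuous_on {p..q} e"
    and d1: "\<And>y. y \<in> {p<..<q} \<Longrightarrow> (e has_real_derivative e' y) (at y)"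
    and d2: "\<And>y. y \<in> {p<..<q} \<Longrightarrow> (e' has_real_derivative e'' y) (at y)"
    and ode: "\<And>y. y \<in> {p<..<q} \<Longrightarrow> e'' y - \<alpha>\<^sup>2 * e y > - G"
    and ends: "e p = 0" "e q = 0" and G: "G \<ge> 0"
    and y: "y \<in> {p..q}"
  shows "e y \<le> G * (y - p) * (q - y) / 2"
proof -
  have "e y - G * (y - p) * (q - y) / 2 \<le> 0"
  proof (rule maximum_principle[where v = "\<lambda>y. e y - G * (y - p) * (q - y) / 2"
        and v' = "\<lambda>y. e' y - G * (p + q - 2 * y) / 2" and v'' = "\<lambda>y. e'' y + G"])
    show "continuous_on {p..q} (\<lambda>y. e y - G * (y - p) * (q - y) / 2)"
      by (intro continuous_intros cont) auto
    fix z assume z: "z \<in> {p<..<q}"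
    show "((\<lambda>y. e y - G * (y - p) * (q - y) / 2) has_real_derivative
        e' z - G * (p + q - 2 * z) / 2) (at z)"
      by (rule derivative_eq_intros d1[OF z] refl | simp add: field_simps)+
    show "((\<lambda>y. e' y - G * (p + q - 2 * y) / 2) has_real_derivative e'' z + G) (at z)"
      by (rule derivative_eq_intros d2[OF z] refl | simp add: field_simps)+
    assume "e z - G * (z - p) * (q - z) / 2 > 0"
    moreover have "G * (z - p) * (q - z) / 2 \<ge> 0"
      using z G by simp
    ultimately have "\<alpha>\<^sup>2 * e z \<ge> 0"
      by simp
    then show "e'' z + G > 0"
      using ode[OF z] by linarith
  qed (use ends y in auto)
  then show ?thesis
    by simp
qed

section \<open>Order, covering and mesh size of a partition\<close>

lemma partition_less:
  assumes "is_partition a b N x" "i < j" "j \<le> N"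
  shows "x i < x j"
  using assms(2,3)
proof (induction j)
  case (Suc j)
  moreover have "x j < x (Suc j)"
    using assms(1) Suc.prems by (simp add: is_partition_def)
  ultimately show ?case
    by (cases "i = j") auto
qed simp

text \<open>\<open>S_space\<close> provides derivatives only off the knots; this makes them
  available on every open subinterval. Knots of index at most \<open>j\<close> lie at or left of
  \<open>x j\<close>, all others at or right of \<open>x (Suc j)\<close>.\<close>

lemma partition_interval_disjoint_knots:
  assumes "is_partition a b N x" "j < N" "y \<in> {x j<..<x (Suc j)}"
  shows "y \<in> {a..b} - knots N x"
proof -
  have mono: "x i \<le> x k" if "i \<le> k" "k \<le> N" for i k
    using partition_less[OF assms(1), of i k] that by (cases "i = k") auto
  have "x 0 = a" "x N = b"
    using assms(1) by (auto simp: is_partition_def)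
  then have "a \<le> x j" "x (Suc j) \<le> b"
    using mono[of 0 j] mono[of "Suc j" N] assms(2) by auto
  moreover have "y \<noteq> x i" if "i \<le> N" for i
    using mono[of i j] mono[of "Suc j" i] that assms(2,3) by (cases "i \<le> j") auto
  then have "y \<notin> knots N x"
    unfolding knots_def by (metis atLeastAtMost_iff imageE)
  ultimately show ?thesis
    using assms(3) by auto
qed

lemma partition_cover:
  assumes "is_partition a b N x" "a < b" "y \<in> {a..b}"
  obtains j where "j < N" "y \<in> {x j..x (Suc j)}"
proof -
  have x: "x 0 = a" "x N = b"
    using assms(1) by (auto simp: is_partition_def)
  \<comment> \<open>\<open>x k\<close> is the first knot not left of \<open>y\<close>, so by
    minimality its predecessor lies strictly left of \<open>y\<close>. If \<open>k = 0\<close> there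
    is no predecessor, but then \<open>y = a\<close> belongs to the first subinterval.\<close>
  define k where "k = (LEAST k. y \<le> x k)"
  have "y \<le> x N"
    using x assms(3) by simp
  then have k: "y \<le> x k" "k \<le> N"
    unfolding k_def by (auto intro: LeastI Least_le)
  show thesis
  proof (cases k)
    case 0
    have "N > 0"
      using x assms(2) by (cases N) auto
    moreover have "y = a"
      using 0 k x assms(3) by auto
    ultimately show thesis
      using that[of 0] partition_less[OF assms(1), of 0 1] x by auto
  next
    case (Suc j)
    then have "\<not> y \<le> x j"
      using not_less_Least[of j "\<lambda>k. y \<le> x k"] k_def by auto
    then show thesis
      using that[of j] k Suc by auto
  qed
qed

lemma mesh_ge:
  assumes "j < N"
  shows "x (Suc j) - x j \<le> mesh N x"
  unfolding mesh_def by (rule Max_ge) (use assms in \<open>auto intro!: rev_image_eqI[of "Suc j"]\<close>)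

section \<open>Pointwise error bound for \<open>S_space\<close>\<close>

lemma S_space_error_bound:
  assumes ab: "a < b" and f: "C2_on_interval a b f"
  shows "\<exists>C>0. \<forall>N x. is_partition a b N x \<longrightarrow>
    (\<forall>s\<in>S_space a b \<alpha> N x. (\<forall>y\<in>knots N x. s y = f y) \<longrightarrow>
       (\<forall>y\<in>{a..b}. \<bar>f y - s y\<bar> \<le> C * (mesh N x)\<^sup>2))"
proof -
  obtain f' f'' where f1: "\<And>y. y \<in> {a..b} \<Longrightarrow> (f has_real_derivative f' y) (at y within {a..b})"
    and f2: "\<And>y. y \<in> {a..b} \<Longrightarrow> (f' has_real_derivative f'' y) (at y within {a..b})"
    and f3: "continuous_on {a..b} f''"
    using f unfolding C2_on_interval_def by blast
  have fc: "continuous_on {a..b} f"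
    using f1 by (rule DERIV_continuous_on)
  have "bounded ((\<lambda>y. f'' y - \<alpha>\<^sup>2 * f y) ` {a..b})"
    by (intro compact_imp_bounded compact_continuous_image continuous_intros f3 fc compact_Icc)
  then obtain B where B: "\<And>y. y \<in> {a..b} \<Longrightarrow> \<bar>f'' y - \<alpha>\<^sup>2 * f y\<bar> \<le> B"
    by (fastforce simp: bounded_iff)
  \<comment> \<open>Adding 1 gives the strict bound required by \<open>barrier_bound\<close> and
    makes the final constant \<open>G / 2\<close> positive. \<open>G\<close> is fixed before the
    partition and the spline, so the constant is uniform in both.\<close>
  define G where "G = \<bar>B\<bar> + 1"
  have G: "G > 0" "\<And>y. y \<in> {a..b} \<Longrightarrow> \<bar>f'' y - \<alpha>\<^sup>2 * f y\<bar> < G"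
    using B by (fastforce simp: G_def)+
  have "\<bar>f y - s y\<bar> \<le> G / 2 * (mesh N x)\<^sup>2"
    if X: "is_partition a b N x" and s: "s \<in> S_space a b \<alpha> N x"
      and interp: "\<And>y. y \<in> knots N x \<Longrightarrow> s y = f y" and y: "y \<in> {a..b}" for N x s y
  proof -
    obtain j where j: "j < N" "y \<in> {x j..x (Suc j)}"
      using partition_cover[OF X ab y] .
    define p q where "p = x j" and "q = x (Suc j)"
    have yI: "y \<in> {p..q}"
      using j by (simp add: p_def q_def)
    have inner: "z \<in> {a..b} - knots N x" if "z \<in> {p<..<q}" for z
      using partition_interval_disjoint_knots[OF X j(1)] that by (simp add: p_def q_def)
    have pk: "p \<in> knots N x" "q \<in> knots N x"
      using j(1) by (auto simp: knots_def p_def q_def)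
    have "p < q"
      using X j(1) by (auto simp: is_partition_def p_def q_def)
    \<comment> \<open>The inclusion of the open subinterval, known from \<open>inner\<close>,
      extends to the end points by taking closures.\<close>
    have "closure {p<..<q} \<subseteq> {a..b}"
      by (rule closure_minimal) (use inner in auto)
    then have sub: "{p..q} \<subseteq> {a..b}"
      using \<open>p < q\<close> by simp
    obtain s' s'' where sc: "continuous_on {a..b} s"
      and s1: "\<And>z. z \<in> {p<..<q} \<Longrightarrow> (s has_real_derivative s' z) (at z)"
      and s2: "\<And>z. z \<in> {p<..<q} \<Longrightarrow> (s' has_real_derivative s'' z) (at z)"
      and s3: "\<And>z. z \<in> {p<..<q} \<Longrightarrow> s'' z - \<alpha>\<^sup>2 * s z = 0"
      using s inner unfolding S_space_def by blast
    \<comment> \<open>At interior points the derivatives of \<open>f\<close> relative to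
      \<open>{a..b}\<close> become ordinary ones and can be subtracted from those of
      \<open>s\<close>.\<close>
    have interior: "z \<in> {a..b}" "at z within {a..b} = at z" if "z \<in> {p<..<q}" for z
      using sub that by (auto intro!: at_within_interior)
    have f1': "(f has_real_derivative f' z) (at z)" if "z \<in> {p<..<q}" for z
      using f1 interior[OF that] by metis
    have f2': "(f' has_real_derivative f'' z) (at z)" if "z \<in> {p<..<q}" for z
      using f2 interior[OF that] by metis
    have cont: "continuous_on {p..q} f" "continuous_on {p..q} s"
      using continuous_on_subset[OF _ sub] fc sc by auto
    have ode: "\<bar>(f'' z - s'' z) - \<alpha>\<^sup>2 * (f z - s z)\<bar> < G" if "z \<in> {p<..<q}" for z
      using G(2)[OF interior(1)[OF that]] s3[OF that] by (simp add: algebra_simps)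
    \<comment> \<open>The barrier is one-sided, so it is applied to \<open>f - s\<close> and then to
      \<open>s - f\<close>.\<close>
    have "f y - s y \<le> G * (y - p) * (q - y) / 2"
    proof (rule barrier_bound[where e = "\<lambda>z. f z - s z" and e' = "\<lambda>z. f' z - s' z"
          and e'' = "\<lambda>z. f'' z - s'' z" and \<alpha> = \<alpha>])
      show "- G < (f'' z - s'' z) - \<alpha>\<^sup>2 * (f z - s z)" if "z \<in> {p<..<q}" for z
        using ode[OF that] by linarith
    qed (use G(1) interp pk yI in \<open>auto intro!: continuous_intros DERIV_diff cont f1' f2' s1 s2\<close>)
    moreover have "s y - f y \<le> G * (y - p) * (q - y) / 2"
    proof (rule barrier_bound[where e = "\<lambda>z. s z - f z" and e' = "\<lambda>z. s' z - f' z"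
          and e'' = "\<lambda>z. s'' z - f'' z" and \<alpha> = \<alpha>])
      show "- G < (s'' z - f'' z) - \<alpha>\<^sup>2 * (s z - f z)" if "z \<in> {p<..<q}" for z
        using ode[OF that] by (simp add: algebra_simps abs_less_iff)
    qed (use G(1) interp pk yI in \<open>auto intro!: continuous_intros DERIV_diff cont f1' f2' s1 s2\<close>)
    ultimately have "\<bar>f y - s y\<bar> \<le> G / 2 * ((y - p) * (q - y))"
      by (simp add: abs_if mult.assoc)
    \<comment> \<open>Each factor is at most \<open>q - p\<close>, hence at most the mesh
      size.\<close>
    also have "(y - p) * (q - y) \<le> mesh N x * mesh N x"
      using mesh_ge[OF j(1), of x] yI by (intro mult_mono) (auto simp: p_def q_def)
    finally show ?thesis
      using G(1) by (simp add: power2_eq_square)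
  qed
  then show ?thesis
    using G(1) by (intro exI[of _ "G / 2"]) auto
qed

section \<open>Transfer to \<open>T_space\<close> through the weight \<open>cosh\<close>\<close>

lemma C2_on_interval_cosh_mult:
  assumes "C2_on_interval a b f"
  shows "C2_on_interval a b (\<lambda>y. cosh (\<alpha> * y) * f y)"
proof -
  obtain f' f'' where f1: "\<And>y. y \<in> {a..b} \<Longrightarrow> (f has_real_derivative f' y) (at y within {a..b})"
    and f2: "\<And>y. y \<in> {a..b} \<Longrightarrow> (f' has_real_derivative f'' y) (at y within {a..b})"
    and f3: "continuous_on {a..b} f''"
    using assms unfolding C2_on_interval_def by blast
  note cont = DERIV_continuous_on[OF f1] DERIV_continuous_on[OF f2] f3
  show ?thesis
    unfolding C2_on_interval_def
  proof (intro exI conjI ballI)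
    fix y assume y: "y \<in> {a..b}"
    show "((\<lambda>y. cosh (\<alpha> * y) * f y) has_real_derivative
        \<alpha> * sinh (\<alpha> * y) * f y + cosh (\<alpha> * y) * f' y) (at y within {a..b})"
      by (rule derivative_eq_intros f1[OF y] refl | simp)+
    show "((\<lambda>y. \<alpha> * sinh (\<alpha> * y) * f y + cosh (\<alpha> * y) * f' y) has_real_derivative
        \<alpha>\<^sup>2 * cosh (\<alpha> * y) * f y + 2 * \<alpha> * sinh (\<alpha> * y) * f' y + cosh (\<alpha> * y) * f'' y)
        (at y within {a..b})"
      by (rule derivative_eq_intros f1[OF y] f2[OF y] refl
          | simp add: algebra_simps power2_eq_square)+
  next
    show "continuous_on {a..b} (\<lambda>y. \<alpha>\<^sup>2 * cosh (\<alpha> * y) * f y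
        + 2 * \<alpha> * sinh (\<alpha> * y) * f' y + cosh (\<alpha> * y) * f'' y)"
      by (intro continuous_intros cont)
  qed
qed

lemma T_space_error_bound:
  assumes "a < b" and "C2_on_interval a b f"
  shows "\<exists>C>0. \<forall>N x. is_partition a b N x \<longrightarrow>
    (\<forall>t\<in>T_space a b \<alpha> N x. (\<forall>y\<in>knots N x. t y = f y) \<longrightarrow>
       (\<forall>y\<in>{a..b}. \<bar>f y - t y\<bar> \<le> C * (mesh N x)\<^sup>2))"
proof -
  \<comment> \<open>This constant belongs to the weighted function
    \<open>cosh (\<alpha> * y) * f y\<close>, to which the bound for \<open>S_space\<close> is
    applied.\<close>
  obtain C where C: "C > 0" and bound: "\<And>N x u y. is_partition a b N x \<Longrightarrow> u \<in> S_space a b \<alpha> N x \<Longrightarrow>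
      \<forall>y\<in>knots N x. u y = cosh (\<alpha> * y) * f y \<Longrightarrow> y \<in> {a..b} \<Longrightarrow>
      \<bar>cosh (\<alpha> * y) * f y - u y\<bar> \<le> C * (mesh N x)\<^sup>2"
    using S_space_error_bound[OF assms(1) C2_on_interval_cosh_mult[OF assms(2)], of \<alpha> \<alpha>] by blast
  have "\<bar>f y - t y\<bar> \<le> C * (mesh N x)\<^sup>2"
    if X: "is_partition a b N x" and t: "t \<in> T_space a b \<alpha> N x"
      and interp: "\<forall>y\<in>knots N x. t y = f y" and y: "y \<in> {a..b}" for N x t y
  proof -
    obtain u where u: "u \<in> S_space a b \<alpha> N x" and tu: "t = (\<lambda>y. sech (\<alpha> * y) * u y)"
      using t by (auto simp: T_space_def)
    have u_eq: "u z = cosh (\<alpha> * z) * t z" for z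
      by (simp add: tu sech_def)
    have "\<bar>f y - t y\<bar> \<le> cosh (\<alpha> * y) * \<bar>f y - t y\<bar>"
      using cosh_real_ge_1[of "\<alpha> * y"] by (simp add: mult_le_cancel_right1)
    also have "\<dots> = \<bar>cosh (\<alpha> * y) * f y - u y\<bar>"
      by (simp add: u_eq abs_mult flip: right_diff_distrib)
    also have "\<dots> \<le> C * (mesh N x)\<^sup>2"
      by (rule bound[OF X u _ y]) (use interp u_eq in auto)
    finally show ?thesis .
  qed
  then show ?thesis
    using C by blast
qed

section \<open>From pointwise bounds to the essential supremum\<close>

lemma continuous_on_T_space:
  assumes "t \<in> T_space a b \<alpha> N x"
  shows "continuous_on {a..b} t"
  using assms by (auto simp: T_space_def S_space_def sech_def intro!: continuous_intros)

text \<open>Continuity serves to secure measurability, without which \<open>esssup\<close> would be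
  infinite; the pointwise bound then holds almost everywhere.\<close>

lemma Linf_norm_le:
  assumes "continuous_on {a..b} g" "\<And>y. y \<in> {a..b} \<Longrightarrow> \<bar>g y\<bar> \<le> c"
  shows "Linf_norm a b g \<le> ereal c"
  unfolding Linf_norm_def
proof (rule esssup_I)
  have "g \<in> borel_measurable (lebesgue_on {a..b})"
    by (rule continuous_imp_measurable_on_sets_lebesgue[OF assms(1)]) simp
  then show "(\<lambda>y. ereal \<bar>g y\<bar>) \<in> borel_measurable (lebesgue_on {a..b})"
    by measurable
  show "AE y in lebesgue_on {a..b}. ereal \<bar>g y\<bar> \<le> ereal c"
    by (rule AE_I2) (use assms(2) in \<open>simp add: space_restrict_space\<close>)
qed

theorem proposition2:
  fixes a b :: real and f :: "real \<Rightarrow> real"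
  assumes "a < b"
    and "C2_on_interval a b f"
  shows "(\<exists>\<alpha>\<^sub>0>0. \<forall>\<alpha>. 0 < \<alpha> \<and> \<alpha> < \<alpha>\<^sub>0 \<longrightarrow>
            (\<exists>C>0. \<forall>N x. is_partition a b N x \<longrightarrow>
               (\<forall>t \<in> T_space a b \<alpha> N x. (\<forall>y \<in> knots N x. t y = f y) \<longrightarrow>
                  Linf_norm a b (\<lambda>y. f y - t y) \<le> ereal (C * (mesh N x)\<^sup>2))))
       \<and> (\<exists>\<alpha>\<^sub>0>0. \<forall>\<alpha>. 0 < \<alpha> \<and> \<alpha> < \<alpha>\<^sub>0 \<longrightarrow>
            (\<exists>C>0. \<forall>N x. is_partition a b N x \<longrightarrow>
               (\<forall>s \<in> S_space a b \<alpha> N x. (\<forall>y \<in> knots N x. s y = f y) \<longrightarrow>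
                  Linf_norm a b (\<lambda>y. f y - s y) \<le> ereal (C * (mesh N x)\<^sup>2))))"
proof -
  have fc: "continuous_on {a..b} f"
    using assms(2) unfolding C2_on_interval_def by (metis DERIV_continuous_on)
  have T: "\<exists>C>0. \<forall>N x. is_partition a b N x \<longrightarrow>
      (\<forall>t \<in> T_space a b \<alpha> N x. (\<forall>y \<in> knots N x. t y = f y) \<longrightarrow>
         Linf_norm a b (\<lambda>y. f y - t y) \<le> ereal (C * (mesh N x)\<^sup>2))" for \<alpha>
  proof -
    obtain C where "C > 0" and C: "\<forall>N x. is_partition a b N x \<longrightarrow>
        (\<forall>t\<in>T_space a b \<alpha> N x. (\<forall>y\<in>knots N x. t y = f y) \<longrightarrow>
           (\<forall>y\<in>{a..b}. \<bar>f y - t y\<bar> \<le> C * (mesh N x)\<^sup>2))"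
      using T_space_error_bound[OF assms] by blast
    then show ?thesis
      by (intro exI[of _ C])
        (auto intro!: Linf_norm_le continuous_intros fc intro: continuous_on_T_space)
  qed
  have S: "\<exists>C>0. \<forall>N x. is_partition a b N x \<longrightarrow>
      (\<forall>s \<in> S_space a b \<alpha> N x. (\<forall>y \<in> knots N x. s y = f y) \<longrightarrow>
         Linf_norm a b (\<lambda>y. f y - s y) \<le> ereal (C * (mesh N x)\<^sup>2))" for \<alpha>
  proof -
    obtain C where "C > 0" and C: "\<forall>N x. is_partition a b N x \<longrightarrow>
        (\<forall>s\<in>S_space a b \<alpha> N x. (\<forall>y\<in>knots N x. s y = f y) \<longrightarrow>
           (\<forall>y\<in>{a..b}. \<bar>f y - s y\<bar> \<le> C * (mesh N x)\<^sup>2))"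
      using S_space_error_bound[OF assms] by blast
    moreover have "continuous_on {a..b} s" if "s \<in> S_space a b \<alpha> N x" for s N x
      using that by (simp add: S_space_def)
    ultimately show ?thesis
      by (intro exI[of _ C]) (auto intro!: Linf_norm_le continuous_intros fc)
  qed
  show ?thesis
    \<comment> \<open>\<open>T\<close> and \<open>S\<close> are available at every \<alpha>, so any
      positive threshold can serve as the witness; 1 is picked for both.\<close>
    using T S by (intro conjI exI[of _ 1]) auto
qed

end
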